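(* Let $d\ge2$ and $N>1$ be integers, and let $S_{\mathbf a,\mathbf b}\subset\mathbb R^d$ be the two-row Hermite normal form simplex associated with $\mathbf a=(1,\ldots,1,N)$ and $\mathbf b=(M-1,\ldots,M-1,M,0)$. If $M\in\{d-1,d\}$, then $S_{\mathbf a,\mathbf b}$ is Ehrhart positive.
   Context: For $\mathbf b=(b_1,\ldots,b_{d-2},M,0)$ and $\mathbf a=(a_1,\ldots,a_{d-1},N)$ in $\mathbb Z^d$, the two-row Hermite normal form simplex $S_{\mathbf a,\mathbf b}$ is the convex hull in $\mathbb R^d$ of $\mathbf v_0=\mathbf 0$, $\mathbf v_i=\mathbf e_i$ (standard unit vectors) for $1\le i\le d-2$, $\mathbf v_{d-1}=\mathbf b$, and $\mathbf v_d=\mathbf a$. In $\mathbf b=(M-1,\ldots,M-1,M,0)$ the first $d-2$ entries equal $M-1$; in $\mathbf a=(1,\ldots,1,N)$ the first $d-1$ entries equal $1$. For a $d$-dimensional lattice polytope $P\subset\mathbb R^d$, the Ehrhart polynomial $\mathcal L_P$ is the polynomial of degree $d$ with $\mathcal L_P(m)=|mP\cap\mathbb Z^d|$ for all integers $m\ge0$. $P$ is Ehrhart positive if all coefficients of $t^0,\ldots,t^d$ in $\mathcal L_P(t)$ are strictly positive. *)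

theory Defs
  imports "HOL-Analysis.Analysis" "HOL-Computational_Algebra.Polynomial"
begin

text \<open>
  Points of \<open>\<real>\<^sup>d\<close> are elements of \<^typ>\<open>real ^ 'n\<close> with \<open>d = CARD('n)\<close>. The index type is finite and
  linearly ordered, so that its elements can be listed as the 1st, 2nd, \<open>\<dots>\<close>, \<open>d\<close>-th coordinate;
  \<open>coord i\<close>, which ranges over \<open>1, \<dots>, d\<close>, is the number of the coordinate \<open>i\<close> in this list.
\<close>

definition coord :: "'n::{finite,linorder} \<Rightarrow> nat" where
  "coord i = card {..i}"

definition real_vec :: "int ^ 'n \<Rightarrow> real ^ 'n" where
  "real_vec x = (\<chi> i. of_int (x $ i))"

definition two_row_hnf_simplex ::
    "int ^ 'n::{finite,linorder} \<Rightarrow> int ^ 'n::{finite,linorder} \<Rightarrow> (real ^ 'n::{finite,linorder}) set" where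
  "two_row_hnf_simplex a b =
     convex hull ({0} \<union> {axis i 1 | i. coord i + 2 \<le> CARD('n)} \<union> {real_vec b, real_vec a})"

text \<open>
  The set counted here is finite whenever \<open>P\<close> is bounded, in particular for every polytope.
\<close>

definition lattice_count :: "(real ^ 'n) set \<Rightarrow> nat \<Rightarrow> nat" where
  "lattice_count P m = card ((\<lambda>x. real m *\<^sub>R x) ` P \<inter> range real_vec)"

definition is_ehrhart_polynomial :: "(real ^ 'n) set \<Rightarrow> real poly \<Rightarrow> bool" where
  "is_ehrhart_polynomial P p \<longleftrightarrow>
     degree p = CARD('n) \<and> (\<forall>m::nat. poly p (of_nat m) = of_nat (lattice_count P m))"

lemma is_ehrhart_polynomial_unique:
  assumes "is_ehrhart_polynomial P p" "is_ehrhart_polynomial P q"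
  shows "p = q"
proof (rule ccontr)
  assume "p \<noteq> q"
  then have "finite {x. poly (p - q) x = 0}"
    by (intro poly_roots_finite) simp
  moreover have "range (of_nat :: nat \<Rightarrow> real) \<subseteq> {x. poly (p - q) x = 0}"
    using assms by (auto simp: is_ehrhart_polynomial_def)
  ultimately have "finite (range (of_nat :: nat \<Rightarrow> real))"
    by (rule rev_finite_subset)
  then show False
    using finite_imageD[of "of_nat :: nat \<Rightarrow> real" UNIV] by (simp add: inj_of_nat)
qed

text \<open>
  For a full-dimensional lattice polytope \<open>P\<close>. The existential quantifier makes the existence of the
  Ehrhart polynomial part of the claim; by the lemma above the witness is unique.
\<close>

definition ehrhart_positive :: "(real ^ 'n) set \<Rightarrow> bool" where
  "ehrhart_positive P \<longleftrightarrow>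
     (\<exists>p. is_ehrhart_polynomial P p \<and> (\<forall>k\<le>CARD('n). coeff p k > 0))"

end

theory Submission imports Defs
begin

text \<open>
  Writing a lattice point of \<open>mP\<close> in terms of the vertices and splitting the coefficients into
  integer and fractional parts identifies it with \<open>f \<in> \<nat>\<^sup>d\<close> and a lattice point of the fundamental
  parallelepiped. The latter are indexed by \<open>r < M\<close> and \<open>s < N\<close>, and for \<open>M \<in> {d - 1, d}\<close> the
  one at \<open>(r, s)\<close> has height \<open>r\<close> or \<open>r + 1\<close> according as \<open>s = 0\<close> or \<open>s > 0\<close>. So the
  Ehrhart polynomial is \<open>A(m) + (N - 1) A(m - 1)\<close>, where \<open>A(x)\<close> is the sum of the binomial coefficients
  \<open>x - r + d\<close> over \<open>d\<close> for \<open>r < M\<close>. Telescoping turns \<open>A\<close> into a difference of two binomial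
  coefficients, which equals, up to the factor \<open>(d + 1)!\<close> and with \<open>k = d + 1 - M\<close>, the product of
  \<open>(x + 1) \<cdots> (x + k)\<close> and \<open>(x + k + 1) \<cdots> (x + d + 1) - x (x - 1) \<cdots> (x - M + 1)\<close>.
  Comparing the roots of the last two products shows that \<open>A(x)\<close> has positive coefficients, and
  similarly that \<open>A(x - 1)\<close> has nonnegative ones.
\<close>

section \<open>Bounded sums and dilated simplices\<close>

text \<open>Stars and bars by induction: splitting off the value \<open>k\<close> at the new index
  leaves the bound \<open>T - k\<close>, and the hockey-stick identity adds up the counts.\<close>

lemma card_sum_le_PiE:
  assumes "finite A"
  shows "finite {f \<in> A \<rightarrow>\<^sub>E (UNIV :: nat set). sum f A \<le> T} \<and>
    card {f \<in> A \<rightarrow>\<^sub>E (UNIV :: nat set). sum f A \<le> T} = (T + card A) choose card A"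
  using assms
proof (induction A arbitrary: T rule: finite_induct)
  case empty
  then show ?case by (simp add: PiE_empty_domain)
next
  case (insert a A)
  let ?S = "\<lambda>A T. {f \<in> A \<rightarrow>\<^sub>E (UNIV :: nat set). sum f A \<le> T}"
  have bij: "bij_betw (\<lambda>(k, f). f(a := k)) (SIGMA k:{..T}. ?S A (T - k)) (?S (insert a A) T)"
  proof (rule bij_betw_byWitness[where f' = "\<lambda>f. (f a, f(a := undefined))"])
    have upd: "sum (f(a := k)) A = sum f A" for f :: "'a \<Rightarrow> nat" and k
      using insert.hyps by (intro sum.cong) auto
    show "(\<lambda>(k, f). f(a := k)) ` (SIGMA k:{..T}. ?S A (T - k)) \<subseteq> ?S (insert a A) T"
      using insert.hyps by (auto simp: upd[unfolded fun_upd_def] PiE_iff extensional_def)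
    show "(\<lambda>f. (f a, f(a := undefined))) ` ?S (insert a A) T \<subseteq> (SIGMA k:{..T}. ?S A (T - k))"
      using insert.hyps by (auto simp: upd[unfolded fun_upd_def] PiE_iff extensional_def)
  qed (use insert.hyps in \<open>auto simp: PiE_iff extensional_def fun_eq_iff\<close>)
  have fin: "finite (SIGMA k:{..T}. ?S A (T - k))"
    using insert.IH by auto
  have "card (?S (insert a A) T) = card (SIGMA k:{..T}. ?S A (T - k))"
    using bij_betw_same_card[OF bij] by simp
  also have "\<dots> = (\<Sum>k\<le>T. (T - k + card A) choose card A)"
    using insert.IH by (subst card_SigmaI) auto
  also have "\<dots> = (\<Sum>k\<le>T. (k + card A) choose card A)"
    using sum.nat_diff_reindex[of "\<lambda>k. (k + card A) choose card A" "Suc T"]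
    by (simp add: lessThan_Suc_atMost)
  also have "\<dots> = (\<Sum>k\<le>T. (card A + k) choose card A)"
    by (simp add: add.commute)
  also have "\<dots> = Suc (card A + T) choose Suc (card A)"
    by (simp only: choose_rising_sum(1)) simp
  finally show ?case
    using bij_betw_finite[OF bij] fin insert.hyps by (simp add: add.commute)
qed

corollary
  fixes T :: nat
  shows finite_sum_le_UNIV: "finite {f :: 'n::finite \<Rightarrow> nat. sum f UNIV \<le> T}"
    and card_sum_le_UNIV:
      "card {f :: 'n \<Rightarrow> nat. sum f UNIV \<le> T} = (T + CARD('n)) choose CARD('n)"
  using card_sum_le_PiE[of "UNIV :: 'n set" T] by (simp_all add: PiE_UNIV_domain)

text \<open>The hull is the image of the standard simplex under the linear map that takes the unit
  vectors to \<open>V\<close>; the vertex 0 absorbs the slack in the sum of the weights.\<close>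

lemma scaled_convex_hull_insert_0_range:
  fixes V :: "'n::finite \<Rightarrow> 'a::real_vector"
  assumes "t \<ge> 0"
  shows "(\<lambda>x. t *\<^sub>R x) ` (convex hull (insert 0 (range V))) =
    {\<Sum>i\<in>UNIV. u i *\<^sub>R V i | u. (\<forall>i. u i \<ge> 0) \<and> sum u UNIV \<le> t}"
proof -
  define T where "T = (\<lambda>x :: real ^ 'n. \<Sum>i\<in>UNIV. (x $ i) *\<^sub>R V i)"
  have lin: "linear T"
    unfolding T_def
    by (intro linearI) (simp_all add: algebra_simps sum.distrib scaleR_sum_right)
  have T_axis: "T (axis i 1) = V i" for i
    unfolding T_def axis_def by (simp add: if_distrib[of "\<lambda>c. c *\<^sub>R _"] cong: if_cong)
  have T0: "T 0 = 0" by (simp add: T_def)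
  have basis: "(Basis :: (real ^ 'n) set) = range (\<lambda>i. axis i 1)"
    by (auto simp: Basis_vec_def)
  have T_img: "T ` (insert 0 Basis) = insert 0 (range V)"
    by (simp add: basis image_image T_axis T0)
  have inj: "inj (\<lambda>i::'n. axis i (1::real))"
    by (auto simp: inj_on_def axis_eq_axis)
  have sumB: "sum ((\<bullet>) x) (Basis :: (real ^ 'n) set) = (\<Sum>i\<in>UNIV. x $ i)" for x
    unfolding basis by (subst sum.reindex[OF inj]) (simp add: inner_axis)
  have hull: "convex hull (insert 0 (range V)) = T ` {x. (\<forall>i. x $ i \<ge> 0) \<and> (\<Sum>i\<in>UNIV. x $ i) \<le> 1}"
    unfolding T_img[symmetric] convex_hull_linear_image[OF lin, symmetric] std_simplex sumB
    by (simp add: basis inner_axis image_iff)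
  show ?thesis
  proof (intro set_eqI iffI)
    fix y assume "y \<in> (\<lambda>x. t *\<^sub>R x) ` (convex hull (insert 0 (range V)))"
    then obtain x where x: "\<forall>i. x $ i \<ge> 0" "(\<Sum>i\<in>UNIV. x $ i) \<le> 1" and y: "y = t *\<^sub>R T x"
      unfolding hull by auto
    have "y = (\<Sum>i\<in>UNIV. (t * x $ i) *\<^sub>R V i)"
      by (simp add: y T_def scaleR_sum_right)
    moreover have "(\<Sum>i\<in>UNIV. t * x $ i) \<le> t"
      using mult_left_mono[OF x(2) assms] by (simp add: sum_distrib_left)
    ultimately show "y \<in> {\<Sum>i\<in>UNIV. u i *\<^sub>R V i | u. (\<forall>i. u i \<ge> 0) \<and> sum u UNIV \<le> t}"
      using x(1) assms by (intro CollectI exI[of _ "\<lambda>i. t * x $ i"]) auto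
  next
    fix y assume "y \<in> {\<Sum>i\<in>UNIV. u i *\<^sub>R V i | u. (\<forall>i. u i \<ge> 0) \<and> sum u UNIV \<le> t}"
    then obtain u where u: "\<And>i. u i \<ge> 0" "sum u UNIV \<le> t" and y: "y = (\<Sum>i\<in>UNIV. u i *\<^sub>R V i)"
      by blast
    define x where "x = (\<chi> i. u i / t)"
    \<comment> \<open>For \<open>t = 0\<close> the division yields 0, but then nonnegativity forces
      every \<open>u i\<close> to be 0 as well.\<close>
    have "u i = t * x $ i" for i
    proof (cases "t = 0")
      case True
      then have "sum u UNIV = 0" using u sum_nonneg[of UNIV u] by force
      then show ?thesis using u(1) True by (simp add: sum_nonneg_eq_0_iff)
    qed (simp add: x_def)
    then have "y = t *\<^sub>R T x"
      by (simp add: y T_def scaleR_sum_right)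
    moreover have "(\<Sum>i\<in>UNIV. x $ i) \<le> 1"
      using u assms by (auto simp: x_def sum_divide_distrib[symmetric] divide_le_eq_1)
    ultimately show "y \<in> (\<lambda>x. t *\<^sub>R x) ` (convex hull (insert 0 (range V)))"
      unfolding hull using u(1) assms by (auto simp: x_def)
  qed
qed

section \<open>Coefficients of products of linear factors\<close>

definition coeffs_pos :: "nat \<Rightarrow> real poly \<Rightarrow> bool" where
  "coeffs_pos n p \<longleftrightarrow> (\<forall>k\<le>n. coeff p k > 0) \<and> (\<forall>k>n. coeff p k = 0)"

definition coeffs_nonneg :: "nat \<Rightarrow> real poly \<Rightarrow> bool" where
  "coeffs_nonneg n p \<longleftrightarrow> (\<forall>k\<le>n. coeff p k \<ge> 0) \<and> (\<forall>k>n. coeff p k = 0)"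

lemma coeff_linear_mult:
  "coeff ([:b, 1:] * p) k = (b * coeff p k + (case k of 0 \<Rightarrow> 0 | Suc j \<Rightarrow> coeff p j) :: real)"
  by (simp add: coeff_pCons)

lemma coeffs_pos_linear_mult:
  assumes "b > 0" "coeffs_pos n p"
  shows "coeffs_pos (Suc n) ([:b, 1:] * p)"
  unfolding coeffs_pos_def coeff_linear_mult
proof (intro conjI allI impI)
  fix k assume "k \<le> Suc n"
  then show "b * coeff p k + (case k of 0 \<Rightarrow> 0 | Suc j \<Rightarrow> coeff p j) > 0"
    using assms unfolding coeffs_pos_def
    by (cases "k = Suc n") (auto split: nat.split intro!: add_pos_pos)
qed (use assms in \<open>auto simp: coeffs_pos_def split: nat.split\<close>)

lemma coeffs_nonneg_linear_mult:
  assumes "b \<ge> 0" "coeffs_nonneg n p"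
  shows "coeffs_nonneg (Suc n) ([:b, 1:] * p)"
  unfolding coeffs_nonneg_def coeff_linear_mult
proof (intro conjI allI impI)
  fix k assume "k \<le> Suc n"
  then show "b * coeff p k + (case k of 0 \<Rightarrow> 0 | Suc j \<Rightarrow> coeff p j) \<ge> 0"
    using assms unfolding coeffs_nonneg_def
    by (cases "k = Suc n") (auto split: nat.split intro!: add_nonneg_nonneg)
qed (use assms in \<open>auto simp: coeffs_nonneg_def split: nat.split\<close>)

lemma coeffs_pos_prod_linear_mult:
  assumes "\<And>i. i < s \<Longrightarrow> b i > 0" "coeffs_pos n p"
  shows "coeffs_pos (s + n) ((\<Prod>i<s. [:b i, 1:]) * p)"
  using assms
proof (induction s)
  case (Suc s)
  have "(\<Prod>i<Suc s. [:b i, 1:]) * p = [:b s, 1:] * ((\<Prod>i<s. [:b i, 1:]) * p)"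
    by (simp only: prod.lessThan_Suc mult_ac)
  then show ?case
    using Suc coeffs_pos_linear_mult[of "b s" "s + n" "(\<Prod>i<s. [:b i, 1:]) * p"] by auto
qed simp

lemma coeffs_nonneg_prod_linear_mult:
  assumes "\<And>i. i < s \<Longrightarrow> b i \<ge> 0" "coeffs_nonneg n p"
  shows "coeffs_nonneg (s + n) ((\<Prod>i<s. [:b i, 1:]) * p)"
  using assms
proof (induction s)
  case (Suc s)
  have "(\<Prod>i<Suc s. [:b i, 1:]) * p = [:b s, 1:] * ((\<Prod>i<s. [:b i, 1:]) * p)"
    by (simp only: prod.lessThan_Suc mult_ac)
  then show ?case
    using Suc coeffs_nonneg_linear_mult[of "b s" "s + n" "(\<Prod>i<s. [:b i, 1:]) * p"] by auto
qed simp

lemma coeff_prod_linear_top: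
  "coeff (\<Prod>i<n. [:b i, 1:]) n = (1 :: real)"
  "k > n \<Longrightarrow> coeff (\<Prod>i<n. [:b i, 1:]) k = (0 :: real)"
proof -
  show gt: "coeff (\<Prod>i<n. [:b i, 1:]) k = (0 :: real)" if "k > n" for n k
    using that
    by (induction n arbitrary: k)
      (auto simp: mult.commute[of _ "[:_, 1:]"] coeff_linear_mult
        simp del: mult_pCons_left mult_pCons_right split: nat.split)
  show "coeff (\<Prod>i<n. [:b i, 1:]) n = (1 :: real)"
    by (induction n)
      (auto simp: mult.commute[of _ "[:_, 1:]"] coeff_linear_mult gt
        simp del: mult_pCons_left mult_pCons_right)
qed

text \<open>The coefficients are elementary symmetric functions of the constant terms, so the
  triangle inequality lets each |a i| be replaced by \<open>b i\<close>.\<close>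

lemma abs_coeff_prod_linear_le:
  fixes a b :: "nat \<Rightarrow> real"
  assumes "\<And>i. i < n \<Longrightarrow> \<bar>a i\<bar> \<le> b i"
  shows "\<bar>coeff (\<Prod>i<n. [:a i, 1:]) k\<bar> \<le> coeff (\<Prod>i<n. [:b i, 1:]) k"
  using assms
proof (induction n arbitrary: k)
  case (Suc n)
  then have IH: "\<bar>coeff (\<Prod>i<n. [:a i, 1:]) k\<bar> \<le> coeff (\<Prod>i<n. [:b i, 1:]) k" for k
    by auto
  have "\<bar>a n * coeff (\<Prod>i<n. [:a i, 1:]) k\<bar> \<le> b n * coeff (\<Prod>i<n. [:b i, 1:]) k"
    unfolding abs_mult using Suc.prems[of n] IH[of k] by (intro mult_mono) auto
  then show ?case
    using IH[of "k - 1"]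
    by (auto simp: mult.commute[of _ "[:_, 1:]"] coeff_linear_mult
        simp del: mult_pCons_left mult_pCons_right split: nat.split)
qed auto

text \<open>Below the top, every monomial of the symmetric function contains a constant term, which
  makes the comparison strict. In the induction, the gap between |a n| and \<open>b n\<close> is
  multiplied by a positive coefficient.\<close>

lemma abs_coeff_prod_linear_less:
  fixes a b :: "nat \<Rightarrow> real"
  assumes "\<And>i. i < n \<Longrightarrow> \<bar>a i\<bar> < b i" "k < n"
  shows "\<bar>coeff (\<Prod>i<n. [:a i, 1:]) k\<bar> < coeff (\<Prod>i<n. [:b i, 1:]) k"
  using assms
proof (induction n arbitrary: k)
  case (Suc n)
  have le: "\<bar>coeff (\<Prod>i<n. [:a i, 1:]) k\<bar> \<le> coeff (\<Prod>i<n. [:b i, 1:]) k" for k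
    using Suc.prems(1) by (intro abs_coeff_prod_linear_le) (auto simp: less_imp_le)
  have pos: "coeff (\<Prod>i<n. [:b i, 1:]) k > 0"
  proof (cases "k = n")
    case False
    then have "\<bar>coeff (\<Prod>i<n. [:a i, 1:]) k\<bar> < coeff (\<Prod>i<n. [:b i, 1:]) k"
      using Suc by auto
    then show ?thesis by linarith
  qed (simp add: coeff_prod_linear_top)
  have "\<bar>a n\<bar> * \<bar>coeff (\<Prod>i<n. [:a i, 1:]) k\<bar> \<le> \<bar>a n\<bar> * coeff (\<Prod>i<n. [:b i, 1:]) k"
    using le by (intro mult_left_mono) auto
  also have "\<dots> < b n * coeff (\<Prod>i<n. [:b i, 1:]) k"
    using pos Suc.prems(1)[of n] by simp
  finally have "\<bar>a n * coeff (\<Prod>i<n. [:a i, 1:]) k\<bar> < b n * coeff (\<Prod>i<n. [:b i, 1:]) k"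
    by (simp add: abs_mult)
  then show ?case
    using le[of "k - 1"]
    by (auto simp: mult.commute[of _ "[:_, 1:]"] coeff_linear_mult
        simp del: mult_pCons_left mult_pCons_right split: nat.split)
qed auto

text \<open>Both products are monic of degree \<open>Suc n\<close>, so their leading terms cancel;
  the lower coefficients are compared one by one.\<close>

lemma coeffs_pos_prod_linear_diff:
  fixes a b :: "nat \<Rightarrow> real"
  assumes "\<And>i. i \<le> n \<Longrightarrow> \<bar>a i\<bar> < b i"
  shows "coeffs_pos n ((\<Prod>i<Suc n. [:b i, 1:]) - (\<Prod>i<Suc n. [:a i, 1:]))"
  unfolding coeffs_pos_def
proof (intro conjI allI impI)
  fix k assume "k \<le> n"
  then have "\<bar>coeff (\<Prod>i<Suc n. [:a i, 1:]) k\<bar> < coeff (\<Prod>i<Suc n. [:b i, 1:]) k"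
    using assms by (intro abs_coeff_prod_linear_less) auto
  then show "coeff ((\<Prod>i<Suc n. [:b i, 1:]) - (\<Prod>i<Suc n. [:a i, 1:])) k > 0"
    unfolding coeff_diff by linarith
next
  fix k assume "n < k"
  then show "coeff ((\<Prod>i<Suc n. [:b i, 1:]) - (\<Prod>i<Suc n. [:a i, 1:])) k = 0"
    by (cases "k = Suc n") (auto simp: coeff_prod_linear_top simp del: prod.lessThan_Suc)
qed

lemma coeffs_nonneg_prod_linear_diff:
  fixes a b :: "nat \<Rightarrow> real"
  assumes "\<And>i. i \<le> n \<Longrightarrow> \<bar>a i\<bar> \<le> b i"
  shows "coeffs_nonneg n ((\<Prod>i<Suc n. [:b i, 1:]) - (\<Prod>i<Suc n. [:a i, 1:]))"
  unfolding coeffs_nonneg_def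
proof (intro conjI allI impI)
  fix k assume "k \<le> n"
  have "\<bar>coeff (\<Prod>i<Suc n. [:a i, 1:]) k\<bar> \<le> coeff (\<Prod>i<Suc n. [:b i, 1:]) k"
    using assms by (intro abs_coeff_prod_linear_le) auto
  then show "coeff ((\<Prod>i<Suc n. [:b i, 1:]) - (\<Prod>i<Suc n. [:a i, 1:])) k \<ge> 0"
    unfolding coeff_diff by linarith
next
  fix k assume "n < k"
  then show "coeff ((\<Prod>i<Suc n. [:b i, 1:]) - (\<Prod>i<Suc n. [:a i, 1:])) k = 0"
    by (cases "k = Suc n") (auto simp: coeff_prod_linear_top simp del: prod.lessThan_Suc)
qed

section \<open>Telescoping and positivity of the candidate polynomial\<close>

text \<open>By Pascal's rule each summand is a difference of two consecutive binomial coefficients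
  with lower index \<open>Suc d\<close>.\<close>

lemma sum_gbinomial_diff_telescope:
  fixes y :: "'a::field_char_0"
  shows "(\<Sum>r<k. (y - of_nat r + of_nat d) gchoose d) =
    ((y + of_nat d + 1) gchoose Suc d) - ((y + of_nat d + 1 - of_nat k) gchoose Suc d)"
proof (induction k)
  case (Suc k)
  have "((y + of_nat d + 1 - of_nat k) gchoose Suc d) =
      ((y - of_nat k + of_nat d) gchoose d) + ((y + of_nat d + 1 - of_nat (Suc k)) gchoose Suc d)"
    using gbinomial_Suc_Suc[of "y - of_nat k + of_nat d" d] by (simp add: algebra_simps)
  then show ?case using Suc by (simp add: algebra_simps)
qed simp

text \<open>
  For \<open>s + n = d\<close>, this is \<open>(d + 1)!\<close> times the polynomial \<open>A(x - c)\<close> of the header with \<open>M = n + 1\<close>,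
  with the common factors of its two binomial coefficients pulled out.
\<close>

definition box_poly :: "nat \<Rightarrow> nat \<Rightarrow> nat \<Rightarrow> real poly" where
  "box_poly s n c = (\<Prod>j<s. [:1 + real j - real c, 1:]) *
     ((\<Prod>i<Suc n. [:real s + real i + 1 - real c, 1:]) - (\<Prod>i<Suc n. [:- real i - real c, 1:]))"

text \<open>With y = x - c and up to the factorial, the telescoped binomials are (y + 1)...(y + s +
  n + 1) and (y - n)...(y + s); both contain (y + 1)...(y + s).\<close>

lemma poly_box_poly:
  "poly (box_poly s n c) x =
    fact (Suc (s + n)) * (\<Sum>r<Suc n. (x - real c - real r + real (s + n)) gchoose (s + n))"
proof -
  define y where "y = x - real c"
  have A: "(\<Prod>j<s. 1 + real j - real c + x) = pochhammer (y + 1) s"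
    by (simp add: pochhammer_prod y_def algebra_simps atLeast0LessThan)
  have B: "(\<Prod>i<Suc n. real s + real i + 1 - real c + x) = pochhammer (y + 1 + real s) (Suc n)"
    unfolding pochhammer_prod atLeast0LessThan by (intro prod.cong) (auto simp: y_def)
  \<comment> \<open>The factors y - i descend, so the index is reversed to match the rising
    \<open>pochhammer\<close>.\<close>
  have C: "(\<Prod>i<Suc n. - real i - real c + x) = pochhammer (y - real n) (Suc n)"
    unfolding pochhammer_prod atLeast0LessThan
    by (subst prod.nat_diff_reindex[symmetric], intro prod.cong) (auto simp: y_def)
  have D: "fact (Suc (s + n)) * ((y + real (s + n) + 1) gchoose Suc (s + n)) =
      pochhammer (y + 1) s * pochhammer (y + 1 + real s) (Suc n)"
    unfolding pochhammer_product'[symmetric] gbinomial_pochhammer' by (simp add: algebra_simps del: fact_Suc)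
  have E: "fact (Suc (s + n)) * ((y + real (s + n) + 1 - real (Suc n)) gchoose Suc (s + n)) =
      pochhammer (y - real n) (Suc n) * pochhammer (y + 1) s"
    using pochhammer_product'[of "y - real n" "Suc n" s]
    unfolding gbinomial_pochhammer' by (simp add: algebra_simps del: fact_Suc)
  show ?thesis
    unfolding box_poly_def sum_gbinomial_diff_telescope poly_mult poly_diff poly_prod
      y_def[symmetric] right_diff_distrib D E
    using A B C by (simp add: algebra_simps)
qed

lemma coeffs_pos_box_poly: "coeffs_pos (s + n) (box_poly s n 0)"
  unfolding box_poly_def
  by (intro coeffs_pos_prod_linear_mult coeffs_pos_prod_linear_diff) auto

text \<open>The shift by 1 turns the strict comparison of \<open>i\<close> with
  \<open>s + i + 1\<close> into that of \<open>i + 1\<close> with \<open>s + i\<close>, an equality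
  when s = 1; the prefactor also acquires the root 0.\<close>

lemma coeffs_nonneg_box_poly:
  assumes "s \<ge> 1"
  shows "coeffs_nonneg (s + n) (box_poly s n 1)"
  unfolding box_poly_def using assms
  by (intro coeffs_nonneg_prod_linear_mult coeffs_nonneg_prod_linear_diff) auto

section \<open>Vertices and the fundamental parallelepiped\<close>

text \<open>
  The indices \<open>l\<close> and \<open>p\<close> are the last and the penultimate coordinate.
\<close>

definition hnf_vertex :: "'n \<Rightarrow> 'n \<Rightarrow> nat \<Rightarrow> nat \<Rightarrow> 'n \<Rightarrow> real ^ 'n::finite" where
  "hnf_vertex l p M N i =
     (if i = l then (\<chi> j. if j = l then real N else 1)
      else if i = p then (\<chi> j. if j = l then 0 else if j = p then real M else real M - 1)
      else axis i 1)"

lemma sum_hnf_vertex: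
  fixes u :: "'n::finite \<Rightarrow> real"
  assumes "p \<noteq> l"
  shows "(\<Sum>i\<in>UNIV. u i *\<^sub>R hnf_vertex l p M N i) $ j =
    (if j = l then real N * u l
     else if j = p then real M * u p + u l
     else u j + (real M - 1) * u p + u l)"
proof -
  have "(\<Sum>i\<in>UNIV. u i *\<^sub>R hnf_vertex l p M N i) $ j = (\<Sum>i\<in>UNIV.
      (if i = l then u l * (if j = l then real N else 1) else 0) +
      (if i = p then u p * (if j = l then 0 else if j = p then real M else real M - 1) else 0) +
      (if i = j then (if j = l \<or> j = p then 0 else u j) else 0))"
    unfolding sum_component
    by (intro sum.cong) (use assms in \<open>auto simp: hnf_vertex_def axis_def\<close>)
  also have "\<dots> = (if j = l then real N * u l
     else if j = p then real M * u p + u l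
     else u j + (real M - 1) * u p + u l)"
    using assms by (simp add: sum.distrib)
  finally show ?thesis .
qed

text \<open>
  The lattice point whose coordinates with respect to the vertices have the integer parts \<open>f\<close>;
  the pairs \<open>(r, s)\<close> with \<open>r < M\<close> and \<open>s < N\<close> enumerate the lattice points of the half-open
  fundamental parallelepiped.
\<close>

definition box_pt :: "'n \<Rightarrow> 'n \<Rightarrow> nat \<Rightarrow> nat \<Rightarrow> nat \<Rightarrow> nat \<Rightarrow> ('n \<Rightarrow> int) \<Rightarrow> int ^ 'n::finite" where
  "box_pt l p M N r s f =
     (\<chi> j. if j = l then int N * f l + int s
           else int M * f p + int r + of_bool (s > 0) + f l + (if j = p then 0 else f j - f p))"

text \<open>This is the solution \<theta> of M \<theta> + s/N = r + [s > 0], the condition at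
  coordinate \<open>p\<close>. Subtracting that coordinate of a lattice point from another one,
  \<open>j\<close> \<noteq> \<open>l\<close>, leaves the difference of the barycentric coordinates
  at \<open>j\<close> and \<open>p\<close>, so these share the fractional part \<theta>.\<close>

definition box_offset :: "nat \<Rightarrow> nat \<Rightarrow> nat \<Rightarrow> nat \<Rightarrow> real" where
  "box_offset M N r s = (real r + of_bool (s > 0) - real s / real N) / real M"

definition box_bary :: "'n \<Rightarrow> nat \<Rightarrow> nat \<Rightarrow> nat \<Rightarrow> nat \<Rightarrow> ('n \<Rightarrow> int) \<Rightarrow> 'n::finite \<Rightarrow> real" where
  "box_bary l M N r s f j = of_int (f j) + (if j = l then real s / real N else box_offset M N r s)"

lemma box_offset_bounds:
  assumes "r < M" "s < N"
  shows "0 \<le> box_offset M N r s" "box_offset M N r s < 1"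
proof -
  \<comment> \<open>The indicator is the ceiling of s/N, which keeps \<open>w\<close> nonnegative
    and below r + 1 \<le> M.\<close>
  define w where "w = real r + of_bool (s > 0) - real s / real N"
  have "0 \<le> w \<and> w < real r + 1"
  proof (cases "s = 0")
    case False
    then have "real s / real N < 1" "real s / real N > 0" using assms by auto
    then show ?thesis using False by (simp add: w_def)
  qed (simp add: w_def)
  moreover have "real r + 1 \<le> real M" using assms by linarith
  ultimately have "0 \<le> w" "w < real M" by linarith+
  then show "0 \<le> box_offset M N r s" "box_offset M N r s < 1"
    using assms by (simp_all add: box_offset_def w_def[symmetric])
qed

lemma real_vec_box_pt:
  assumes "p \<noteq> l" "M > 0" "N > 0"
  shows "real_vec (box_pt l p M N r s f) = (\<Sum>i\<in>UNIV. box_bary l M N r s f i *\<^sub>R hnf_vertex l p M N i)"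
  unfolding vec_eq_iff sum_hnf_vertex[OF assms(1)]
proof
  fix j
  have "real M * box_offset M N r s = real r + of_bool (s > 0) - real s / real N"
    using assms by (simp add: box_offset_def)
  moreover have "real N * (real s / real N) = real s" using assms by simp
  ultimately show "real_vec (box_pt l p M N r s f) $ j =
      (if j = l then real N * box_bary l M N r s f l
       else if j = p then real M * box_bary l M N r s f p + box_bary l M N r s f l
       else box_bary l M N r s f j + (real M - 1) * box_bary l M N r s f p + box_bary l M N r s f l)"
    using assms(1) by (simp add: real_vec_def box_pt_def box_bary_def algebra_simps)
qed

text \<open>The system is triangular: coordinate \<open>l\<close> determines the coefficient at
  \<open>l\<close>, then \<open>p\<close> the one at \<open>p\<close>, then every other
  \<open>j\<close> its own.\<close>

lemma hnf_vertex_coords_unique: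
  assumes "p \<noteq> l" "M > 0" "N > 0"
    and eq: "(\<Sum>i\<in>UNIV. u i *\<^sub>R hnf_vertex l p M N i) = (\<Sum>i\<in>UNIV. v i *\<^sub>R hnf_vertex l p M N i)"
  shows "u = v"
proof
  fix j
  note E = arg_cong[OF eq, of "\<lambda>x. x $ _", unfolded sum_hnf_vertex[OF assms(1)]]
  have l: "u l = v l" using E[of l] assms by simp
  have p: "u p = v p" using E[of p] assms l by simp
  show "u j = v j" using E[of j] l p by (auto split: if_splits)
qed

text \<open>
  With \<open>S\<close> the integer on the right and \<open>\<theta>\<close> the offset, the sum of the coordinates is \<open>S\<close> for
  \<open>M = d - 1\<close> and \<open>S - \<theta>\<close> for \<open>M = d\<close>; since \<open>0 \<le> \<theta> < 1\<close>, rounding makes no difference.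
\<close>

lemma sum_box_bary_le_iff:
  fixes f :: "'n::finite \<Rightarrow> int"
  assumes "r < M" "s < N" "M = CARD('n) - 1 \<or> M = CARD('n)"
  shows "(\<Sum>j\<in>UNIV. box_bary l M N r s f j) \<le> real m \<longleftrightarrow>
    sum f UNIV + int r + of_bool (s > 0) \<le> int m"
proof -
  define \<theta> where "\<theta> = box_offset M N r s"
  have \<theta>: "0 \<le> \<theta>" "\<theta> < 1" using box_offset_bounds[OF assms(1,2)] by (auto simp: \<theta>_def)
  have M\<theta>: "real M * \<theta> = real r + of_bool (s > 0) - real s / real N"
    using assms by (simp add: \<theta>_def box_offset_def)
  define S where "S = sum f UNIV + int r + of_bool (s > 0)"
  have "(\<Sum>j\<in>UNIV. box_bary l M N r s f j) =
      (\<Sum>j\<in>UNIV. of_int (f j) + \<theta> + (if j = l then real s / real N - \<theta> else 0))"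
    by (intro sum.cong) (auto simp: box_bary_def \<theta>_def)
  also have "\<dots> = of_int (sum f UNIV) + (real CARD('n) - 1) * \<theta> + real s / real N"
    by (simp add: sum.distrib algebra_simps)
  finally have sum: "(\<Sum>j\<in>UNIV. box_bary l M N r s f j) =
      of_int (sum f UNIV) + (real CARD('n) - 1) * \<theta> + real s / real N" .
  show ?thesis
  proof (cases "M = CARD('n)")
    case True
    then have "(\<Sum>j\<in>UNIV. box_bary l M N r s f j) = of_int S - \<theta>"
      using sum M\<theta> by (simp add: S_def algebra_simps)
    then show ?thesis using \<theta> unfolding S_def[symmetric] by linarith
  next
    case False
    then have "real CARD('n) - 1 = real M" using assms by (simp add: of_nat_diff)
    then have "(\<Sum>j\<in>UNIV. box_bary l M N r s f j) = of_int S"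
      using sum M\<theta> by (simp add: S_def algebra_simps)
    then show ?thesis unfolding S_def[symmetric] by linarith
  qed
qed

lemma int_mult_add_eq_iff:
  assumes "r < k" "r' < k"
  shows "int k * q + int r = int k * q' + int r' \<longleftrightarrow> q = q' \<and> r = r'"
proof
  assume eq: "int k * q + int r = int k * q' + int r'"
  have "(int k * q + int r) div int k = q" "(int k * q' + int r') div int k = q'"
    using assms by auto
  then show "q = q' \<and> r = r'" using eq by auto
qed auto

text \<open>Division with remainder by N at \<open>l\<close> recovers \<open>f l\<close> and
  \<open>s\<close>; division by M at \<open>p\<close> then recovers \<open>f p\<close> and
  \<open>r\<close>; the other coordinates yield the rest of \<open>f\<close>.\<close>

lemma box_pt_inject:
  assumes "p \<noteq> l" "r < M" "r' < M" "s < N" "s' < N"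
    and eq: "box_pt l p M N r s f = box_pt l p M N r' s' f'"
  shows "r = r' \<and> s = s' \<and> f = f'"
proof -
  note E = arg_cong[OF eq, of "\<lambda>x. x $ _"]
  have l: "f l = f' l" "s = s'"
    using E[of l] int_mult_add_eq_iff[OF assms(4,5)] by (auto simp: box_pt_def)
  have p: "f p = f' p" "r = r'"
    using E[of p] int_mult_add_eq_iff[OF assms(2,3)] l assms(1) by (auto simp: box_pt_def)
  have "f j = f' j" for j
    using E[of j] l p by (auto simp: box_pt_def split: if_splits)
  then show ?thesis using l p by auto
qed

lemma box_pt_surj:
  fixes x :: "int ^ 'n::finite"
  assumes "p \<noteq> l" "M > 0" "N > 0"
  obtains r s f where "r < M" "s < N" "x = box_pt l p M N r s f"
proof
  define s where "s = nat (x $ l mod int N)"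
  \<comment> \<open>What remains of coordinate \<open>p\<close> without the contributions of
    \<open>l\<close> has to be M * f p + r.\<close>
  define t where "t = x $ p - x $ l div int N - of_bool (s > 0)"
  define r where "r = nat (t mod int M)"
  \<comment> \<open>The last case solves x_j - x_p = f j - f p.\<close>
  define f where "f = (\<lambda>j. if j = l then x $ l div int N
    else if j = p then t div int M else x $ j - x $ p + t div int M)"
  have s: "int s = x $ l mod int N" and r: "int r = t mod int M"
    using assms by (auto simp: s_def r_def)
  show "r < M" "s < N"
    using assms by (auto simp: s_def r_def nat_less_iff)
  have t: "int M * (t div int M) + int r = t" unfolding r by simp
  have "x $ l = box_pt l p M N r s f $ l"
    by (simp add: box_pt_def f_def s)
  moreover have "int M * f p + int r + of_bool (s > 0) + f l = x $ p"
    using assms(1) t by (simp add: f_def) (simp add: t_def)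
  ultimately have "x $ j = box_pt l p M N r s f $ j" for j
    using assms(1) by (cases "j = l") (simp_all add: box_pt_def, simp_all add: f_def)
  then show "x = box_pt l p M N r s f" by (simp add: vec_eq_iff)
qed

section \<open>Counting lattice points in the dilated simplex\<close>

lemma inj_real_vec: "inj real_vec"
  by (auto simp: inj_def real_vec_def vec_eq_iff)

text \<open>Points of the dilated simplex have nonnegative barycentric coordinates with sum at most
  \<open>m\<close>. As the fractional parts lie in [0, 1), nonnegativity means f \<ge> 0, and the
  bound on the sum becomes one on the sum of \<open>f\<close> plus the height r + [s > 0].\<close>

lemma bij_betw_box_pt:
  fixes l p :: "'n::finite"
  assumes "p \<noteq> l" "M > 0" "N > 0" "M = CARD('n) - 1 \<or> M = CARD('n)"
  shows "bij_betw (\<lambda>((r, s), f). real_vec (box_pt l p M N r s (int \<circ> f)))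
    (SIGMA (r, s):{..<M} \<times> {..<N}. {f. sum f UNIV + (r + of_bool (s > 0)) \<le> m})
    ((\<lambda>x. real m *\<^sub>R x) ` (convex hull (insert 0 (range (hnf_vertex l p M N)))) \<inter> range real_vec)"
    (is "bij_betw ?\<Phi> ?D ?L")
  unfolding bij_betw_def
proof
  show "inj_on ?\<Phi> ?D"
  proof (rule inj_onI)
    fix v v' assume v: "v \<in> ?D" "v' \<in> ?D" "?\<Phi> v = ?\<Phi> v'"
    obtain r s f r' s' f' where eq: "v = ((r, s), f)" "v' = ((r', s'), f')"
      by (metis surj_pair)
    have "box_pt l p M N r s (int \<circ> f) = box_pt l p M N r' s' (int \<circ> f')"
      using v(3) by (simp add: eq inj_eq[OF inj_real_vec])
    then have "r = r' \<and> s = s' \<and> int \<circ> f = int \<circ> f'"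
      using v(1,2) by (intro box_pt_inject[OF assms(1)]) (auto simp: eq)
    then show "v = v'"
      by (auto simp: eq fun_eq_iff)
  qed
next
  have le_iff: "(\<Sum>j\<in>UNIV. box_bary l M N r s (int \<circ> f) j) \<le> real m \<longleftrightarrow>
      sum f UNIV + (r + of_bool (s > 0)) \<le> m" if "r < M" "s < N" for r s f
  proof -
    have "sum f UNIV + (r + of_bool (s > 0)) \<le> m \<longleftrightarrow>
        int (sum f UNIV + (r + of_bool (s > 0))) \<le> int m"
      by (simp only: zle_int)
    then show ?thesis
      using sum_box_bary_le_iff[OF that assms(4), of l "int \<circ> f" m] by (simp add: o_def add_ac)
  qed
  show "?\<Phi> ` ?D = ?L"
  proof (intro set_eqI iffI)
    fix x assume "x \<in> ?\<Phi> ` ?D"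
    then obtain r s f where rs: "r < M" "s < N" and f: "sum f UNIV + (r + of_bool (s > 0)) \<le> m"
      and x: "x = real_vec (box_pt l p M N r s (int \<circ> f))" by auto
    have "box_bary l M N r s (int \<circ> f) i \<ge> 0" for i
      using box_offset_bounds[OF rs] by (simp add: box_bary_def)
    moreover have "sum (box_bary l M N r s (int \<circ> f)) UNIV \<le> real m"
      using le_iff[OF rs] f by blast
    ultimately show "x \<in> ?L"
      unfolding scaled_convex_hull_insert_0_range[OF of_nat_0_le_iff] x
      using real_vec_box_pt[OF assms(1-3)] by blast
  next
    fix x assume "x \<in> ?L"
    then obtain u z where u: "\<And>i. u i \<ge> 0" "sum u UNIV \<le> real m"
      and x: "x = (\<Sum>i\<in>UNIV. u i *\<^sub>R hnf_vertex l p M N i)" "x = real_vec z"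
      unfolding scaled_convex_hull_insert_0_range[OF of_nat_0_le_iff] by blast
    obtain r s f where rs: "r < M" "s < N" and z: "z = box_pt l p M N r s f"
      using box_pt_surj[OF assms(1-3)] by blast
    have ub: "u = box_bary l M N r s f"
      using x(1) unfolding x(2) z real_vec_box_pt[OF assms(1-3)]
      by (rule hnf_vertex_coords_unique[OF assms(1-3), symmetric])
    have "f i \<ge> 0" for i
    proof -
      have "real s / real N < 1" using rs by auto
      then have "of_int (f i) > (-1 :: real)"
        using u(1)[of i] box_offset_bounds[OF rs] by (auto simp: ub box_bary_def split: if_splits)
      then show ?thesis by linarith
    qed
    then have f: "f = int \<circ> (nat \<circ> f)" by (auto simp: fun_eq_iff)
    then have "sum (nat \<circ> f) UNIV + (r + of_bool (s > 0)) \<le> m"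
      using le_iff[OF rs, of "nat \<circ> f"] u(2) ub by simp
    then show "x \<in> ?\<Phi> ` ?D"
      using rs x(2) by (intro image_eqI[of _ _ "((r, s), nat \<circ> f)"]) (simp_all add: z flip: f)
  qed
qed

text \<open>If m < c, the bound on \<open>c\<close> puts the upper entry m - c + d between 0 and d -
  1, so the binomial coefficient vanishes just as the empty set requires. The polynomial formula
  thus holds for every \<open>m\<close>.\<close>

lemma card_sum_add_le_gbinomial:
  assumes "c \<le> CARD('n::finite)"
  shows "finite {f :: 'n \<Rightarrow> nat. sum f UNIV + c \<le> m}"
    and "real (card {f :: 'n \<Rightarrow> nat. sum f UNIV + c \<le> m}) =
      (real m - real c + real CARD('n)) gchoose CARD('n)"
proof -
  have "real m - real c + real CARD('n) = of_nat (m + CARD('n) - c)"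
    using assms by simp
  then have g: "(real m - real c + real CARD('n)) gchoose CARD('n) =
      real ((m + CARD('n) - c) choose CARD('n))"
    by (simp only: binomial_gbinomial)
  show "finite {f :: 'n \<Rightarrow> nat. sum f UNIV + c \<le> m}"
    by (rule finite_subset[OF _ finite_sum_le_UNIV[of m]]) auto
  show "real (card {f :: 'n \<Rightarrow> nat. sum f UNIV + c \<le> m}) =
      (real m - real c + real CARD('n)) gchoose CARD('n)"
  proof (cases "c \<le> m")
    case True
    then have "{f :: 'n \<Rightarrow> nat. sum f UNIV + c \<le> m} = {f. sum f UNIV \<le> m - c}" by auto
    then show ?thesis using True g by (simp add: card_sum_le_UNIV)
  next
    case False
    then have "{f :: 'n \<Rightarrow> nat. sum f UNIV + c \<le> m} = {}" by auto
    then show ?thesis using False assms unfolding g by (simp add: binomial_eq_0)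
  qed
qed

lemma lattice_count_hnf_vertex_hull:
  fixes l p :: "'n::finite"
  assumes "p \<noteq> l" "M > 0" "N > 0" "M = CARD('n) - 1 \<or> M = CARD('n)"
  defines "d \<equiv> CARD('n)"
  shows "real (lattice_count (convex hull (insert 0 (range (hnf_vertex l p M N)))) m) =
    (\<Sum>r<M. (real m - real r + real d) gchoose d) +
    (real N - 1) * (\<Sum>r<M. (real m - 1 - real r + real d) gchoose d)"
proof -
  let ?F = "\<lambda>r s. {f :: 'n \<Rightarrow> nat. sum f UNIV + (r + of_bool (s > 0)) \<le> m}"
  \<comment> \<open>The height is at most r + 1 \<le> M \<le> d, so the binomial formula applies
    even for small \<open>m\<close>.\<close>
  have c: "r + of_bool (s > (0::nat)) \<le> CARD('n)" if "r < M" for r s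
    using that assms(4) by (cases "s > 0") auto
  have "lattice_count (convex hull (insert 0 (range (hnf_vertex l p M N)))) m =
      card (SIGMA (r, s):{..<M} \<times> {..<N}. ?F r s)"
    unfolding lattice_count_def using bij_betw_same_card[OF bij_betw_box_pt[OF assms(1-4), of m]] by simp
  also have "\<dots> = (\<Sum>(r, s)\<in>{..<M} \<times> {..<N}. card (?F r s))"
    using card_sum_add_le_gbinomial(1)[OF c] by (subst card_SigmaI) (auto simp: case_prod_beta)
  also have "\<dots> = (\<Sum>r<M. \<Sum>s<N. card (?F r s))"
    by (simp add: sum.cartesian_product)
  finally have "real (lattice_count (convex hull (insert 0 (range (hnf_vertex l p M N)))) m) =
      (\<Sum>r<M. \<Sum>s<N. real (card (?F r s)))"
    by simp
  also have "\<dots> = (\<Sum>r<M. \<Sum>s<N. (real m - real (r + of_bool (s > 0)) + real d) gchoose d)"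
    unfolding d_def by (intro sum.cong refl card_sum_add_le_gbinomial(2) c) auto
  also have "\<dots> = (\<Sum>r<M. ((real m - real r + real d) gchoose d) +
      (real N - 1) * ((real m - 1 - real r + real d) gchoose d))"
  proof (intro sum.cong refl)
    fix r
    \<comment> \<open>The term s = 0 is split off; the other N - 1 values of \<open>s\<close> give
      equal summands.\<close>
    obtain k where N: "N = Suc k" using assms(3) by (cases N) auto
    show "(\<Sum>s<N. (real m - real (r + of_bool (s > 0)) + real d) gchoose d) =
        ((real m - real r + real d) gchoose d) + (real N - 1) * ((real m - 1 - real r + real d) gchoose d)"
      unfolding N sum.lessThan_Suc_shift by (simp add: algebra_simps)
  qed
  finally show ?thesis by (simp add: sum.distrib sum_distrib_left)
qed

lemma ehrhart_positive_hnf_vertex_hull: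
  fixes l p :: "'n::finite"
  assumes "p \<noteq> l" "M > 0" "N > 0" "M = CARD('n) - 1 \<or> M = CARD('n)"
  shows "ehrhart_positive (convex hull (insert 0 (range (hnf_vertex l p M N))))"
proof -
  define d where "d = CARD('n)"
  \<comment> \<open>This is 2 for M = d - 1 and 1 for M = d, so the shifted \<open>box_poly\<close>
    is covered in both cases.\<close>
  define s where "s = d + 1 - M"
  obtain n where n: "M = Suc n" using assms(2) by (cases M) auto
  have s: "s \<ge> 1" "s + n = d" using assms n by (auto simp: s_def d_def)
  define q where "q = smult (1 / fact (Suc d)) (box_poly s n 0 + smult (real N - 1) (box_poly s n 1))"
  have pos: "coeffs_pos d (box_poly s n 0)" and nonneg: "coeffs_nonneg d (box_poly s n 1)"
    using coeffs_pos_box_poly[of s n] coeffs_nonneg_box_poly[OF s(1), of n] s(2) by simp_all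
  have q_pos: "coeff q k > 0" if "k \<le> d" for k
    using pos nonneg that assms(3) unfolding q_def coeffs_pos_def coeffs_nonneg_def
    by (auto intro!: divide_pos_pos add_pos_nonneg mult_nonneg_nonneg)
  have "coeff q k = 0" if "k > d" for k
    using pos nonneg that unfolding q_def coeffs_pos_def coeffs_nonneg_def by simp
  then have "degree q = d"
    using q_pos[of d] by (intro antisym degree_le le_degree) auto
  moreover have "poly q (real m) = real (lattice_count (convex hull (insert 0 (range (hnf_vertex l p M N)))) m)" for m
    unfolding lattice_count_hnf_vertex_hull[OF assms] q_def
    by (simp add: poly_box_poly add_divide_distrib s(2) d_def[symmetric] n del: fact_Suc sum.lessThan_Suc)
  ultimately show ?thesis
    using q_pos unfolding ehrhart_positive_def is_ehrhart_polynomial_def d_def by blast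
qed

section \<open>Numbered coordinates and the simplex of the theorem\<close>

lemma bij_betw_coord: "bij_betw coord (UNIV :: 'n::{finite,linorder} set) {1..CARD('n)}"
proof -
  have less: "coord i < coord j" if "i < j" for i j :: 'n
    unfolding coord_def using that by (intro psubset_card_mono) auto
  have inj: "inj (coord :: 'n \<Rightarrow> nat)"
    by (intro linorder_injI) (use less in fastforce)
  have "coord i \<in> {1..CARD('n)}" for i :: 'n
    unfolding coord_def by (auto intro: card_mono simp: Suc_le_eq card_gt_0_iff)
  then have "range (coord :: 'n \<Rightarrow> nat) = {1..CARD('n)}"
    using inj by (intro card_subset_eq) (auto simp: card_image)
  then show ?thesis using inj by (simp add: bij_betw_def)
qed

theorem theorem5p12:
  fixes M N :: int and a b :: "int ^ 'n::{finite,linorder}"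
  assumes "CARD('n) \<ge> 2" and "N > 1"
    and "M \<in> {int CARD('n) - 1, int CARD('n)}"
    and "a = (\<chi> i. if coord i = CARD('n) then N else 1)"
    and "b = (\<chi> i. if coord i = CARD('n) then 0
                   else if coord i = CARD('n) - 1 then M
                   else M - 1)"
  shows "ehrhart_positive (two_row_hnf_simplex a b)"
proof -
  note bij = bij_betw_coord[where 'n = 'n]
  \<comment> \<open>As d \<ge> 2, both d and d - 1 lie in the range 1, ..., d of
    \<open>coord\<close>, which provides the last and the penultimate index.\<close>
  have "CARD('n) \<in> range (coord :: 'n \<Rightarrow> nat)" "CARD('n) - 1 \<in> range (coord :: 'n \<Rightarrow> nat)"
    using bij assms(1) unfolding bij_betw_def by auto
  then obtain l p :: 'n where l: "coord l = CARD('n)" and p: "coord p = CARD('n) - 1"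
    by (metis imageE)
  have coord_l: "coord i = CARD('n) \<longleftrightarrow> i = l" and coord_p: "coord i = CARD('n) - 1 \<longleftrightarrow> i = p" for i
    using bij l p unfolding bij_betw_def by (metis UNIV_I inj_on_def)+
  have pl: "p \<noteq> l" using l p assms(1) by auto
  have coord_unit: "coord i + 2 \<le> CARD('n) \<longleftrightarrow> i \<noteq> l \<and> i \<noteq> p" for i
  proof -
    have "coord i \<le> CARD('n)" using bij unfolding bij_betw_def by auto
    then show ?thesis using coord_l[of i] coord_p[of i] by linarith
  qed
  define M' N' where "M' = nat M" and "N' = nat N"
  then have M': "M = int M'" and N': "N = int N'" using assms(1-3) by auto
  have "hnf_vertex l p M' N' l = real_vec a" "hnf_vertex l p M' N' p = real_vec b"
    using pl by (auto simp: hnf_vertex_def real_vec_def vec_eq_iff assms(4,5) coord_l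
        coord_p[unfolded One_nat_def] M' N')
  moreover have "hnf_vertex l p M' N' i = axis i 1" if "i \<noteq> l" "i \<noteq> p" for i
    using that by (simp add: hnf_vertex_def)
  moreover have "range (hnf_vertex l p M' N') =
      {hnf_vertex l p M' N' i | i. i \<noteq> l \<and> i \<noteq> p} \<union> {hnf_vertex l p M' N' p, hnf_vertex l p M' N' l}"
    by auto
  ultimately have "range (hnf_vertex l p M' N') = {axis i 1 | i. i \<noteq> l \<and> i \<noteq> p} \<union> {real_vec b, real_vec a}"
    by force
  then have "two_row_hnf_simplex a b = convex hull (insert 0 (range (hnf_vertex l p M' N')))"
    unfolding two_row_hnf_simplex_def coord_unit by (simp add: insert_commute)
  \<comment> \<open>Positivity of \<open>M'\<close> comes from M \<ge> d - 1 \<ge> 1.\<close>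
  moreover have "M' = CARD('n) - 1 \<or> M' = CARD('n)" "M' > 0" "N' > 0"
    using assms(1-3) M' N' by auto
  ultimately show ?thesis
    using ehrhart_positive_hnf_vertex_hull[OF pl] by simp
qed

end
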